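(* Let $r\ge 2$ be an integer and let $\mathcal{H}$ be a finite simple hypergraph of rank $r$ without isolated vertices. Then $\gamma(\mathcal{H})\leq (r-1)\,\nu(\mathcal{H})$.
   Context: A (finite) hypergraph $\mathcal{H}=(V,E)$ consists of a finite set $V$ of vertices and a collection $E$ of non-empty subsets of $V$, called edges. It is simple if no edge is contained in any other edge and $|e|\ge 2$ for all $e\in E$. The rank of $\mathcal{H}$ is $\max_{e\in E}|e|$ (edges need not all have the same size). A vertex is isolated if it lies in no edge. The matching number $\nu(\mathcal{H})$ is the maximum size of a set of pairwise disjoint edges of $\mathcal{H}$. A set $D\subseteq V$ is a dominating set if for every $v\in V\setminus D$ there exist $u\in D$ and an edge $e\in E$ with $u,v\in e$; the domination number $\gamma(\mathcal{H})$ is the minimum cardinality of a dominating set. *)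

theory Defs
  imports Main
begin

text \<open>
  A hypergraph is given by its vertex set and its edge set. Taking the edges to be a set rather
  than a multiset loses nothing for simple hypergraphs, where no edge may be repeated.
\<close>

definition hypergraph :: "'a set \<Rightarrow> 'a set set \<Rightarrow> bool" where
  "hypergraph V E \<longleftrightarrow> finite V \<and> (\<forall>e\<in>E. e \<subseteq> V \<and> e \<noteq> {})"

definition simple_hypergraph :: "'a set \<Rightarrow> 'a set set \<Rightarrow> bool" where
  "simple_hypergraph V E \<longleftrightarrow> hypergraph V E \<and>
     (\<forall>e\<in>E. \<forall>f\<in>E. e \<subseteq> f \<longrightarrow> e = f) \<and> (\<forall>e\<in>E. 2 \<le> card e)"

text \<open>The rank is meaningful only for a nonempty edge set; \<open>Max {}\<close> is an unspecified number.\<close>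

definition hypergraph_rank :: "'a set set \<Rightarrow> nat" where
  "hypergraph_rank E = Max (card ` E)"

definition isolated_vertex :: "'a set \<Rightarrow> 'a set set \<Rightarrow> 'a \<Rightarrow> bool" where
  "isolated_vertex V E v \<longleftrightarrow> v \<in> V \<and> (\<forall>e\<in>E. v \<notin> e)"

definition hypergraph_matching :: "'a set set \<Rightarrow> 'a set set \<Rightarrow> bool" where
  "hypergraph_matching E M \<longleftrightarrow> M \<subseteq> E \<and> pairwise disjnt M"

definition matching_number :: "'a set set \<Rightarrow> nat" where
  "matching_number E = Max {card M | M. hypergraph_matching E M}"

definition dominating_set :: "'a set \<Rightarrow> 'a set set \<Rightarrow> 'a set \<Rightarrow> bool" where
  "dominating_set V E D \<longleftrightarrow> D \<subseteq> V \<and> (\<forall>v\<in>V - D. \<exists>u\<in>D. \<exists>e\<in>E. u \<in> e \<and> v \<in> e)"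

definition domination_number :: "'a set \<Rightarrow> 'a set set \<Rightarrow> nat" where
  "domination_number V E = Min {card D | D. dominating_set V E D}"

end

theory Submission
  imports Defs
begin

text \<open>
  Deleting edges as long as they still cover \<open>V\<close> can only raise the domination number and lower the
  matching number, so one may work with a minimal edge cover \<open>C\<close>. By minimality every \<open>e \<in> C\<close> has a
  private vertex \<open>p e\<close>, lying in no other edge of \<open>C\<close>. Let \<open>M \<subseteq> C\<close> be a maximal matching. An edge of
  \<open>C\<close> outside \<open>M\<close> meets some \<open>e \<in> M\<close>, necessarily in a vertex other than \<open>p e\<close>, so the union of the
  sets \<open>e - {p e}\<close> with \<open>e \<in> M\<close> meets every edge of \<open>C\<close>. Hence it is dominating, and it has at most
  \<open>(r - 1) * card M\<close> vertices.
\<close>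

lemma minimal_cover_exists:
  assumes "finite E" "\<Union>E = V"
  obtains C where "C \<subseteq> E" "\<Union>C = V" "\<And>C'. C' \<subset> C \<Longrightarrow> \<Union>C' \<noteq> V"
proof -
  let ?S = "{C \<in> Pow E. \<Union>C = V}"
  have "finite ?S"
    using assms(1) by simp
  moreover have "E \<in> ?S"
    using assms(2) by simp
  ultimately have "\<exists>C\<in>?S. C \<subseteq> E \<and> (\<forall>C'\<in>?S. C' \<subseteq> C \<longrightarrow> C = C')"
    by (rule finite_has_minimal2)
  then obtain C where C: "C \<subseteq> E" "\<Union>C = V" and min: "\<forall>C'\<in>?S. C' \<subseteq> C \<longrightarrow> C = C'"
    by (elim bexE conjE CollectE)
  show thesis
  proof (rule that[OF C] notI)+
    fix C'
    assume "C' \<subset> C" "\<Union>C' = V"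
    then have "C' \<in> ?S" "C' \<subseteq> C"
      using C(1) by auto
    then have "C = C'"
      using min by simp
    then show False
      using \<open>C' \<subset> C\<close> by simp
  qed
qed

text \<open>If every vertex of \<open>e\<close> lay in a further edge of \<open>C\<close>, then
  \<open>C - {e}\<close> would still cover \<open>V\<close>, against minimality.\<close>

lemma minimal_cover_private_vertex:
  assumes "\<Union>C = V" "\<And>C'. C' \<subset> C \<Longrightarrow> \<Union>C' \<noteq> V" "e \<in> C"
  shows "\<exists>v\<in>e. \<forall>f\<in>C. v \<in> f \<longrightarrow> f = e"
proof (rule ccontr)
  assume "\<not> ?thesis"
  then have "\<Union>(C - {e}) = V"
    using assms(1) by blast
  moreover have "C - {e} \<subset> C"
    using \<open>e \<in> C\<close> by blast
  ultimately show False
    using assms(2) by blast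
qed

lemma maximal_matching_exists:
  assumes "finite E" "{} \<notin> E"
  obtains M where "hypergraph_matching E M" "\<And>f. f \<in> E \<Longrightarrow> \<exists>e\<in>M. f \<inter> e \<noteq> {}"
proof -
  let ?S = "Collect (hypergraph_matching E)"
  have "?S \<subseteq> Pow E" "{} \<in> ?S"
    by (auto simp: hypergraph_matching_def)
  then have "finite ?S" "{} \<in> ?S"
    using assms(1) by (simp_all add: finite_subset)
  then obtain M where "M \<in> ?S" and max: "\<And>M'. M' \<in> ?S \<Longrightarrow> M \<subseteq> M' \<Longrightarrow> M = M'"
    using finite_has_maximal2 by metis
  show thesis
  proof (rule that)
    show matching: "hypergraph_matching E M"
      using \<open>M \<in> ?S\<close> by simp
    fix f
    assume "f \<in> E"
    show "\<exists>e\<in>M. f \<inter> e \<noteq> {}"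
    proof (rule ccontr)
      assume disjoint: "\<not> ?thesis"
      then have "hypergraph_matching E (insert f M)"
        using matching \<open>f \<in> E\<close>
        by (auto simp: hypergraph_matching_def pairwise_insert disjnt_def)
      \<comment> \<open>Maximality alone does not exclude that \<open>f\<close> already belongs to
        \<open>M\<close>. In that case \<open>f\<close> is disjoint from itself, so it is the empty
        edge, which is ruled out.\<close>
      then have "f \<in> M"
        using max[of "insert f M"] by blast
      then have "f \<inter> f = {}"
        using disjoint by blast
      then show False
        using \<open>f \<in> E\<close> assms(2) by simp
    qed
  qed
qed

lemma hypergraph_finite_edges:
  assumes "hypergraph V E"
  shows "finite E"
  using assms finite_subset[of E "Pow V"] by (auto simp: hypergraph_def)

lemma card_le_hypergraph_rank:
  assumes "finite E" "e \<in> E"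
  shows "card e \<le> hypergraph_rank E"
  using assms by (simp add: hypergraph_rank_def)

lemma card_le_matching_number:
  assumes "finite E" "hypergraph_matching E M"
  shows "card M \<le> matching_number E"
proof -
  have "{card M | M. hypergraph_matching E M} \<subseteq> card ` Pow E"
    by (auto simp: hypergraph_matching_def)
  then have "finite {card M | M. hypergraph_matching E M}"
    using assms(1) by (meson finite_Pow_iff finite_imageI finite_subset)
  then show ?thesis
    using assms(2) by (auto simp: matching_number_def intro: Max_ge)
qed

lemma domination_number_le_card:
  assumes "finite V" "dominating_set V E D"
  shows "domination_number V E \<le> card D"
proof -
  have "{card D | D. dominating_set V E D} \<subseteq> card ` Pow V"
    by (auto simp: dominating_set_def)
  then have "finite {card D | D. dominating_set V E D}"
    using assms(1) by (meson finite_Pow_iff finite_imageI finite_subset)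
  then show ?thesis
    using assms(2) by (auto simp: domination_number_def intro: Min_le)
qed

text \<open>A vertex outside \<open>D\<close> lies in some edge of \<open>C\<close>. That edge also
  contains a point of \<open>D\<close>, so it is itself the edge of \<open>E\<close> that witnesses
  domination.\<close>

lemma transversal_of_cover_dominating:
  assumes "D \<subseteq> V" "C \<subseteq> E" "\<Union>C = V" "\<And>e. e \<in> C \<Longrightarrow> e \<inter> D \<noteq> {}"
  shows "dominating_set V E D"
  unfolding dominating_set_def using assms by blast

lemma private_vertices_transversal:
  assumes matching: "hypergraph_matching C M" "\<And>f. f \<in> C \<Longrightarrow> \<exists>e\<in>M. f \<inter> e \<noteq> {}"
    and priv: "\<And>e f. e \<in> C \<Longrightarrow> f \<in> C \<Longrightarrow> p e \<in> f \<Longrightarrow> f = e"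
    and two: "\<And>e. e \<in> C \<Longrightarrow> 2 \<le> card e"
    and "f \<in> C"
  shows "f \<inter> (\<Union>e\<in>M. e - {p e}) \<noteq> {}"
proof (cases "f \<in> M")
  case True
  \<comment> \<open>An edge of the matching loses only its own private vertex, and
    \<open>two\<close> guarantees that another vertex remains.\<close>
  have "f - {p f} \<noteq> {}"
  proof
    assume "f - {p f} = {}"
    then have "card f \<le> card {p f}"
      by (intro card_mono) auto
    then show False
      using two[OF \<open>f \<in> C\<close>] by simp
  qed
  then show ?thesis
    using True by blast
next
  case False
  obtain e where "e \<in> M" "f \<inter> e \<noteq> {}"
    using matching(2) \<open>f \<in> C\<close> by blast
  \<comment> \<open>Otherwise privacy would give \<open>f = e\<close>, putting \<open>f\<close> into
    \<open>M\<close>. So any common vertex of \<open>f\<close> and \<open>e\<close> survives the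
    removal of \<open>p e\<close>.\<close>
  moreover have "p e \<notin> f"
    using priv[of e f] matching(1) \<open>e \<in> M\<close> \<open>f \<in> C\<close> False
    by (auto simp: hypergraph_matching_def)
  ultimately show ?thesis
    by blast
qed

theorem theorem1p2:
  fixes V :: "'a set" and E :: "'a set set" and r :: nat
  assumes "2 \<le> r"
    and "simple_hypergraph V E"
    and "hypergraph_rank E = r"
    and "\<not> (\<exists>v. isolated_vertex V E v)"
  shows "domination_number V E \<le> (r - 1) * matching_number E"
proof -
  have hyp: "hypergraph V E" and two: "\<And>e. e \<in> E \<Longrightarrow> 2 \<le> card e"
    using assms(2) by (auto simp: simple_hypergraph_def)
  have "finite V" and edges: "\<And>e. e \<in> E \<Longrightarrow> e \<subseteq> V" "{} \<notin> E"
    using hyp by (auto simp: hypergraph_def)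
  have "finite E"
    using hyp by (rule hypergraph_finite_edges)
  \<comment> \<open>This is where the absence of isolated vertices enters.\<close>
  have "\<Union>E = V"
    using assms(4) edges(1) by (auto simp: isolated_vertex_def)
  with \<open>finite E\<close> obtain C where C: "C \<subseteq> E" "\<Union>C = V" "\<And>C'. C' \<subset> C \<Longrightarrow> \<Union>C' \<noteq> V"
    by (rule minimal_cover_exists) blast
  have "\<forall>e\<in>C. \<exists>v\<in>e. \<forall>f\<in>C. v \<in> f \<longrightarrow> f = e"
    using minimal_cover_private_vertex[OF C(2,3)] by simp
  then obtain p where p: "\<And>e. e \<in> C \<Longrightarrow> p e \<in> e"
    and priv: "\<And>e f. e \<in> C \<Longrightarrow> f \<in> C \<Longrightarrow> p e \<in> f \<Longrightarrow> f = e"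
    by metis
  have "finite C" "{} \<notin> C"
    using C(1) \<open>finite E\<close> edges(2) by (auto intro: finite_subset)
  then obtain M where M: "hypergraph_matching C M" "\<And>f. f \<in> C \<Longrightarrow> \<exists>e\<in>M. f \<inter> e \<noteq> {}"
    by (rule maximal_matching_exists) blast
  have "M \<subseteq> C" and matching: "hypergraph_matching E M"
    using M(1) C(1) by (auto simp: hypergraph_matching_def)
  have "finite M"
    using \<open>M \<subseteq> C\<close> \<open>finite C\<close> by (rule finite_subset)
  define D where "D = (\<Union>e\<in>M. e - {p e})"
  have "e \<inter> D \<noteq> {}" if "e \<in> C" for e
    unfolding D_def using private_vertices_transversal[OF M priv _ that] two C(1) by blast
  moreover have "D \<subseteq> V"
    unfolding D_def using \<open>M \<subseteq> C\<close> C(2) by blast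
  ultimately have "dominating_set V E D"
    using C(1,2) by (intro transversal_of_cover_dominating)
  then have "domination_number V E \<le> card D"
    using \<open>finite V\<close> by (intro domination_number_le_card)
  also have "\<dots> \<le> (\<Sum>e\<in>M. card (e - {p e}))"
    unfolding D_def using \<open>finite M\<close> by (rule card_UN_le)
  also have "\<dots> \<le> (\<Sum>e\<in>M. r - 1)"
  \<comment> \<open>Since \<open>p e\<close> lies in \<open>e\<close>, removing it lowers the size
    by exactly one. The rank is compared only with edges in \<open>M\<close>, so the unspecified
    \<open>Max {}\<close> does no harm when \<open>E\<close> is empty: the sum is then empty
    too.\<close>
  proof (rule sum_mono)
    fix e
    assume "e \<in> M"
    then have "e \<in> C" "e \<in> E"
      using \<open>M \<subseteq> C\<close> C(1) by auto
    then show "card (e - {p e}) \<le> r - 1"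
      using p card_le_hypergraph_rank[OF \<open>finite E\<close>] assms(3) by (simp add: diff_le_mono)
  qed
  also have "\<dots> = (r - 1) * card M"
    by simp
  also have "\<dots> \<le> (r - 1) * matching_number E"
    using card_le_matching_number[OF \<open>finite E\<close> matching] by (rule mult_le_mono2)
  finally show ?thesis .
qed

end
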